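(* Let $\{\alpha_i\}_{i=0}^\infty$ be a sequence of real numbers. If $\{\alpha_i\}_{i=0}^\infty$ is a discrete multiplier sequence, then it is a multiplier sequence in the classical sense; that is, the linear operator on $\mathbb{R}[x]$ determined by $x^i\mapsto\alpha_i x^i$ $(i\ge 0)$ sends every hyperbolic polynomial to a hyperbolic polynomial.
   Context: A polynomial in $\mathbb{R}[x]$ is called hyperbolic if all its zeros are real; by convention the zero polynomial is hyperbolic. For a hyperbolic $p$, $\operatorname{mesh}(p)$ is the minimal distance between its roots; if $p$ has a multiple root, then $\operatorname{mesh}(p):=0$; polynomials of degree at most $1$ are defined to have mesh $+\infty$. $\mathcal{HP}^{+}_{\ge 1}$ denotes the set of hyperbolic polynomials with mesh at least $1$ and with only non-negative zeros; by convention the zero polynomial and the nonzero constants belong to it. The Pochhammer polynomials are $(x)_0=1$, $(x)_i=x(x-1)\cdots(x-i+1)$ for $i\ge 1$. A real sequence $\{\alpha_i\}_{i=0}^\infty$ is called a discrete multiplier sequence if the linear operator $T:\mathbb{R}[x]\to\mathbb{R}[x]$ determined by $T((x)_i)=\alpha_i (x)_i$ for all $i\ge 0$ satisfies $T(\mathcal{HP}^{+}_{\ge 1})\subseteq\mathcal{HP}^{+}_{\ge 1}$. *)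

theory Defs
  imports
    Complex_Main
    "HOL-Computational_Algebra.Polynomial"
    "HOL-Library.Extended_Real"
begin

definition hyperbolic :: "real poly \<Rightarrow> bool" where
  "hyperbolic p \<longleftrightarrow>
     p = 0 \<or> (\<forall>z::complex. poly (map_poly complex_of_real p) z = 0 \<longrightarrow> z \<in> \<real>)"

text \<open>
  The mesh is only meaningful for hyperbolic polynomials. For these, the minimum in the last
  branch ranges over a finite nonempty set: degree at least 2 and no multiple root give at
  least two distinct real roots.
\<close>

definition mesh :: "real poly \<Rightarrow> ereal" where
  "mesh p =
     (if degree p \<le> 1 then \<infinity>
      else if \<exists>x. order x p \<ge> 2 then 0
      else ereal (Min {\<bar>x - y\<bar> | x y. poly p x = 0 \<and> poly p y = 0 \<and> x \<noteq> y}))"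

text \<open>
  The zero polynomial belongs to the set by convention; it needs a separate disjunct because
  every real number is a zero of it. Nonzero constants satisfy the second disjunct.
\<close>

definition HP_plus_mesh_ge1 :: "real poly set" where
  "HP_plus_mesh_ge1 =
     {p. p = 0 \<or> (hyperbolic p \<and> mesh p \<ge> 1 \<and> (\<forall>x. poly p x = 0 \<longrightarrow> x \<ge> 0))}"

text \<open>The falling factorial as a polynomial; \<^const>\<open>pochhammer\<close> is the rising one.\<close>

definition pochhammer_poly :: "nat \<Rightarrow> real poly" where
  "pochhammer_poly i = (\<Prod>k<i. [:- real k, 1:])"

definition diagonal_operator ::
  "(nat \<Rightarrow> real poly) \<Rightarrow> (nat \<Rightarrow> real) \<Rightarrow> (real poly \<Rightarrow> real poly) \<Rightarrow> bool" where
  "diagonal_operator b \<alpha> T \<longleftrightarrow>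
     Vector_Spaces.linear smult smult T \<and> (\<forall>i. T (b i) = smult (\<alpha> i) (b i))"

text \<open>
  In the next two definitions the operator exists and is unique, by
  \<open>diagonal_operator_pochhammer_ex1\<close> and \<open>diagonal_operator_monom_ex1\<close> below.
\<close>

definition discrete_multiplier_sequence :: "(nat \<Rightarrow> real) \<Rightarrow> bool" where
  "discrete_multiplier_sequence \<alpha> \<longleftrightarrow>
     (\<exists>T. diagonal_operator pochhammer_poly \<alpha> T \<and> T ` HP_plus_mesh_ge1 \<subseteq> HP_plus_mesh_ge1)"

definition multiplier_sequence :: "(nat \<Rightarrow> real) \<Rightarrow> bool" where
  "multiplier_sequence \<alpha> \<longleftrightarrow>
     (\<exists>T. diagonal_operator (\<lambda>i. monom 1 i) \<alpha> T \<and> (\<forall>p. hyperbolic p \<longrightarrow> hyperbolic (T p)))"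

lemma vector_space_poly: "vector_space (smult :: real \<Rightarrow> real poly \<Rightarrow> real poly)"
  by unfold_locales (auto simp: smult_add_right smult_add_left)

lemma vector_space_pair_poly:
  "vector_space_pair (smult :: real \<Rightarrow> real poly \<Rightarrow> real poly)
     (smult :: real \<Rightarrow> real poly \<Rightarrow> real poly)"
  by (intro vector_space_pair.intro vector_space_poly)

lemma diagonal_operator_ex1:
  assumes deg: "\<And>i. degree (b i) = i" and nz: "\<And>i. b i \<noteq> 0"
  shows "\<exists>!T. diagonal_operator b \<alpha> T"
proof -
  interpret P: vector_space_pair "smult :: real \<Rightarrow> real poly \<Rightarrow> real poly"
    "smult :: real \<Rightarrow> real poly \<Rightarrow> real poly"
    by (rule vector_space_pair_poly)
  have inj: "inj b" using deg by (metis injI)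
  have span: "p \<in> P.vs1.span (range b)" for p
  proof (induction "degree p" arbitrary: p rule: less_induct)
    case less
    define n where "n = degree p"
    define c where "c = lead_coeff p / lead_coeff (b n)"
    define q where "q = p - smult c (b n)"
    have bn: "smult c (b n) \<in> P.vs1.span (range b)"
      by (intro P.vs1.span_scale P.vs1.span_base) auto
    have "coeff (b n) n \<noteq> 0"
      using nz deg by (metis leading_coeff_0_iff)
    then have lc: "coeff q n = 0"
      by (simp add: q_def c_def n_def deg)
    have dq: "degree q \<le> n"
      unfolding q_def by (intro degree_diff_le) (auto simp: n_def deg)
    have "q \<in> P.vs1.span (range b)"
    proof (cases "q = 0")
      case True
      then show ?thesis by (simp add: P.vs1.span_zero)
    next
      case False
      then have "degree q \<noteq> n" using lc by auto
      then show ?thesis using dq less unfolding n_def by simp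
    qed
    then have "q + smult c (b n) \<in> P.vs1.span (range b)"
      using bn by (rule P.vs1.span_add)
    then show ?case by (simp add: q_def)
  qed
  have indep: "P.vs1.independent (range b)"
  proof
    assume "P.vs1.dependent (range b)"
    then obtain S u where S: "finite S" "S \<subseteq> range b" "(\<Sum>v\<in>S. smult (u v) v) = 0"
      and ex: "\<exists>v\<in>S. u v \<noteq> 0"
      by (auto simp: P.vs1.dependent_explicit)
    define I where "I = {i. b i \<in> S \<and> u (b i) \<noteq> 0}"
    have "I = b -` {v\<in>S. u v \<noteq> 0}" by (auto simp: I_def)
    moreover have "finite {v\<in>S. u v \<noteq> 0}" using S(1) by simp
    ultimately have finI: "finite I" by (metis finite_vimageI inj)
    have neI: "I \<noteq> {}" using ex S(2) by (auto simp: I_def)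
    define n where "n = Max I"
    have nI: "n \<in> I" using finI neI by (simp add: n_def)
    have "coeff (\<Sum>v\<in>S. smult (u v) v) n = (\<Sum>v\<in>S. u v * coeff v n)"
      by (simp add: coeff_sum)
    also have "\<dots> = (\<Sum>v\<in>{b n}. u v * coeff v n)"
    proof (rule sum.mono_neutral_right)
      show "\<forall>v\<in>S - {b n}. u v * coeff v n = 0"
      proof
        fix v assume v: "v \<in> S - {b n}"
        then obtain i where i: "v = b i" using S(2) by auto
        show "u v * coeff v n = 0"
        proof (cases "u v = 0")
          case False
          then have "i \<in> I" using v i by (auto simp: I_def)
          then have "i \<le> n" using finI by (simp add: n_def)
          then have "i < n" using v i by (metis DiffD2 insertI1 le_neq_implies_less)
          then show ?thesis by (simp add: i coeff_eq_0 deg)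
        qed auto
      qed
    qed (use S nI in \<open>auto simp: I_def\<close>)
    also have "\<dots> \<noteq> 0"
      using nI nz[of n] deg[of n] by (auto simp: I_def) (metis leading_coeff_0_iff)
    finally show False using S(3) by simp
  qed
  obtain T where T: "Vector_Spaces.linear smult smult T"
    "\<forall>v\<in>range b. T v = smult (\<alpha> (inv b v)) v"
    using P.linear_independent_extend[OF indep, of "\<lambda>v. smult (\<alpha> (inv b v)) v"] by blast
  show ?thesis
  proof (rule ex1I)
    show "diagonal_operator b \<alpha> T"
      using T inj by (simp add: diagonal_operator_def)
    fix U assume U: "diagonal_operator b \<alpha> U"
    show "U = T"
    proof
      fix p
      show "U p = T p"
        by (rule P.linear_eq_on[OF _ T(1) span])
          (use U T inj in \<open>auto simp: diagonal_operator_def\<close>)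
    qed
  qed
qed

lemma degree_pochhammer_poly: "degree (pochhammer_poly i) = i"
  by (simp add: pochhammer_poly_def degree_prod_eq_sum_degree)

lemma diagonal_operator_pochhammer_ex1: "\<exists>!T. diagonal_operator pochhammer_poly \<alpha> T"
  by (rule diagonal_operator_ex1) (auto simp: degree_pochhammer_poly, simp add: pochhammer_poly_def)

lemma diagonal_operator_monom_ex1: "\<exists>!T. diagonal_operator (\<lambda>i. monom 1 i) \<alpha> T"
  by (rule diagonal_operator_ex1) (auto simp: degree_monom_eq)

end

theory Submission
  imports Defs
    "HOL-Computational_Algebra.Formal_Power_Series"
    "HOL-Computational_Algebra.Fundamental_Theorem_Algebra"
begin

text \<open>
  Seen from far away, the lattice spacing disappears: substituting \<open>x \<mapsto> N x\<close> and dividing by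
  \<open>N ^ k\<close> turns the Pochhammer polynomial \<open>(x)\<^sub>k\<close> into \<open>x ^ k\<close> as \<open>N\<close> grows, and turns mesh at least \<open>1\<close>
  into mesh at least \<open>1 / N\<close>. This is applied to one family only. The polynomial with zeros
  \<open>N, \<dots>, N + n - 1\<close> has mesh \<open>1\<close> for \<open>n \<ge> 2\<close>, and the Chu--Vandermonde identity gives its Pochhammer
  coordinates. In the limit, the classical diagonal operator sends \<open>(1 - x) ^ n\<close> to
  \<open>\<Sum>k\<le>n. (n choose k) \<alpha>\<^sub>k (- x) ^ k\<close>, and by Hurwitz's theorem this Jensen polynomial is zero or has
  all its zeros in \<open>[0, \<infinity>)\<close> (\<open>discrete_multiplier_jensen_zeros\<close>).

  By the classical argument of Polya and Schur these special values already control all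
  hyperbolic polynomials: the image of \<open>p\<close> is the Schur--Szego composition of \<open>p\<close> with a Jensen
  polynomial. The form of the composition theorem used is \<open>szego_sum_nonzero\<close>. Each
  zero of the Jensen polynomial acts on the other factor as a polar derivative, and by Laguerre's
  theorem (\<open>laguerre\<close>) polar derivatives with poles in the upper half plane preserve the property
  of having all zeros in the open lower half plane. A hyperbolic \<open>p\<close> is brought into that
  situation by the translation \<open>p (x + \<i> \<epsilon>)\<close>, and a second use of Hurwitz's theorem lets \<open>\<epsilon>\<close> tend to
  \<open>0\<close>. So the image has no zero in the upper half plane, and having real coefficients it
  has none in the lower half plane.

  Hurwitz's theorem is needed for bounded degree only. There it follows from an elementary estimate
  (\<open>norm_poly_le_zero_free_ball\<close>).
\<close>

section \<open>Limits of polynomials without zeros in an open set\<close>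

text \<open>Splitting off one linear factor at a time, while keeping track of where all zeros lie.\<close>

lemma complex_poly_roots_induct [consumes 2, case_names const mult]:
  fixes f :: "complex poly"
  assumes "f \<noteq> 0"
    and "{z. poly f z = 0} \<subseteq> R"
    and const: "\<And>c. c \<noteq> 0 \<Longrightarrow> P [:c:]"
    and mult: "\<And>r g. r \<in> R \<Longrightarrow> g \<noteq> 0 \<Longrightarrow> P g \<Longrightarrow> P ([:-r, 1:] * g)"
  shows "P f"
  using assms(1,2)
proof (induction "degree f" arbitrary: f)
  case 0
  then obtain c where "f = [:c:]" by (metis degree_eq_zeroE)
  with 0 const show ?case by auto
next
  case (Suc n)
  then have "\<not> constant (poly f)" by (simp add: constant_degree)
  then obtain r where r: "poly f r = 0" using fundamental_theorem_of_algebra by blast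
  then obtain g where g: "f = [:-r, 1:] * g" by (metis dvdE poly_eq_0_iff_dvd)
  with Suc.prems(1) have g0: "g \<noteq> 0" by auto
  then have "degree f = Suc (degree g)" unfolding g by (subst degree_mult_eq) auto
  with Suc.hyps(2) have "n = degree g" by simp
  then have "P g" using Suc.hyps(1)[of g] g0 Suc.prems(2) by (auto simp: g)
  moreover have "r \<in> R" using r Suc.prems(2) by blast
  ultimately show ?case unfolding g using mult g0 by blast
qed

text \<open>
  Each linear factor satisfies
  \<open>\<bar>z1 - r\<bar> \<le> \<bar>z1 - z0\<bar> + \<bar>z0 - r\<bar> \<le> (1 + \<bar>z1 - z0\<bar> / \<delta>) \<bar>z0 - r\<bar>\<close> when its zero
  \<open>r\<close> keeps distance \<open>\<delta>\<close> from \<open>z0\<close>. The constant depends only on the degree, not on the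
  polynomial; this uniformity is what makes the estimate survive limits.
\<close>

lemma norm_poly_le_zero_free_ball:
  fixes f :: "complex poly"
  assumes \<delta>: "\<delta> > 0" and n: "degree f \<le> n"
    and free: "f \<noteq> 0 \<Longrightarrow> (\<And>z. poly f z = 0 \<Longrightarrow> dist z z0 \<ge> \<delta>)"
  shows "norm (poly f z1) \<le> (1 + dist z1 z0 / \<delta>) ^ n * norm (poly f z0)"
proof (cases "f = 0")
  case False
  let ?c = "1 + dist z1 z0 / \<delta>"
  have c: "?c \<ge> 1" using \<delta> by simp
  from False have "{z. poly f z = 0} \<subseteq> {z. dist z z0 \<ge> \<delta>}" using free by blast
  with False have "norm (poly f z1) \<le> ?c ^ degree f * norm (poly f z0)"
  proof (induction rule: complex_poly_roots_induct)
    case (mult r g)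
    have "\<delta> \<le> norm (z0 - r)" using mult(1) by (simp add: dist_norm norm_minus_commute)
    then have "dist z1 z0 \<le> dist z1 z0 / \<delta> * norm (z0 - r)"
      using \<delta> mult_left_mono[of \<delta> "norm (z0 - r)" "dist z1 z0"] by (simp add: field_simps)
    moreover have "norm (z1 - r) \<le> dist z1 z0 + norm (z0 - r)"
      by (metis dist_norm dist_triangle)
    ultimately have "norm (z1 - r) \<le> ?c * norm (z0 - r)"
      by (simp add: ring_distribs)
    then have "norm (z1 - r) * norm (poly g z1)
        \<le> (?c * norm (z0 - r)) * (?c ^ degree g * norm (poly g z0))"
      using mult(3) c by (intro mult_mono) auto
    moreover have "degree ([:-r, 1:] * g) = Suc (degree g)"
      using mult(2) by (subst degree_mult_eq) auto
    moreover have "poly ([:-r, 1:] * g) z = (z - r) * poly g z" for z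
      by (simp add: algebra_simps)
    ultimately show ?case by (simp only: norm_mult power_Suc mult_ac)
  qed auto
  also have "\<dots> \<le> ?c ^ n * norm (poly f z0)"
    using c n by (intro mult_right_mono power_increasing) auto
  finally show ?thesis .
qed auto

text \<open>
  Hurwitz's theorem for bounded degree. Pointwise convergence suffices: by the previous estimate,
  a zero of the limit at one point of \<open>U\<close> forces the limit to vanish at every point of the plane.
  Zero polynomials are admitted in the sequence because the operators below may annihilate
  some of their arguments.
\<close>

lemma hurwitz_polynomials:
  fixes f :: "nat \<Rightarrow> complex poly"
  assumes "open U"
    and deg: "\<And>i. degree (f i) \<le> n"
    and free: "\<And>i z. f i \<noteq> 0 \<Longrightarrow> z \<in> U \<Longrightarrow> poly (f i) z \<noteq> 0"
    and lim: "\<And>z. (\<lambda>i. poly (f i) z) \<longlonglongrightarrow> poly g z"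
    and "g \<noteq> 0" "z0 \<in> U"
  shows "poly g z0 \<noteq> 0"
proof
  assume zero: "poly g z0 = 0"
  obtain \<delta> where \<delta>: "\<delta> > 0" "\<And>z. dist z z0 < \<delta> \<Longrightarrow> z \<in> U"
    using assms(1,6) by (auto simp: open_dist)
  have "poly g z1 = 0" for z1
  proof -
    let ?c = "(1 + dist z1 z0 / \<delta>) ^ n"
    have "norm (poly (f i) z1) \<le> ?c * norm (poly (f i) z0)" for i
      by (rule norm_poly_le_zero_free_ball) (use \<delta> deg free not_le in blast)+
    moreover have "(\<lambda>i. ?c * norm (poly (f i) z0)) \<longlonglongrightarrow> ?c * norm (poly g z0)"
      by (intro tendsto_intros lim)
    ultimately have "norm (poly g z1) \<le> ?c * norm (poly g z0)"
      using LIMSEQ_le[OF tendsto_norm[OF lim]] by blast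
    then show ?thesis by (simp add: zero)
  qed
  then have "g = 0" using poly_all_0_iff_0 by blast
  with assms(5) show False by simp
qed

section \<open>The polar derivative and Laguerre's theorem\<close>

text \<open>
  For \<open>c = 1\<close> this is Laguerre's polar derivative of \<open>g\<close>, read as a form of degree \<open>n\<close>, with
  respect to the pole \<open>w\<close>. In homogeneous coordinates the pole is \<open>w : c\<close>, so that \<open>c = 0\<close> puts it at
  infinity and gives a multiple of the ordinary derivative.
\<close>

definition polar_derivative :: "complex \<Rightarrow> complex \<Rightarrow> nat \<Rightarrow> complex poly \<Rightarrow> complex poly" where
  "polar_derivative c w n g = smult (of_nat n * c) g + [:w, -c:] * pderiv g"

lemma coeff_polar_derivative:
  "coeff (polar_derivative c w n g) k = c * (of_nat n - of_nat k) * coeff g k + w * of_nat (Suc k) * coeff g (Suc k)"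
  by (cases k) (simp_all add: polar_derivative_def coeff_pderiv algebra_simps)

text \<open>
  Dividing by \<open>[:-r, 1:] * g\<close> turns this into a recursion for the quotient
  \<open>polar_derivative c w n g / g\<close>; it says that the quotient at \<open>x\<close> is the sum of
  \<open>(w - c r) / (x - r)\<close> over the zeros \<open>r\<close> of \<open>g\<close>.
\<close>

lemma polar_derivative_linear_factor:
  "polar_derivative c w (Suc n) ([:-r, 1:] * g)
    = [:-r, 1:] * polar_derivative c w n g + smult (w - c * r) g"
  unfolding polar_derivative_def pderiv_mult
  by (rule poly_eqI, case_tac n) (simp_all add: pderiv_pCons coeff_pCons algebra_simps split: nat.splits)

text \<open>
  The map \<open>r \<mapsto> (z - c r) / (x - r)\<close> has no zero and no pole in the open lower half plane, so it
  sends that half plane to a disk or half plane avoiding \<open>0\<close>. Such a set lies on one side of a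
  line through \<open>0\<close>. If \<open>Im x > 0\<close>, the centre of the disk is the value at \<open>r = cnj x\<close>,
  which is \<open>z - c cnj x\<close> up to a positive multiple of \<open>-\<i>\<close>; its conjugate is the
  rotation factor used here.
\<close>

lemma Re_mobius_pos:
  fixes z x r :: complex
  assumes "Im z > 0" "Im x \<ge> 0" "Im r < 0" "c \<ge> 0"
  shows "Re (\<i> * (cnj z - of_real c * x) * ((z - of_real c * r) / (x - r))) > 0"
proof -
  have "x \<noteq> r" using assms by auto
  obtain a b where z: "z = Complex a b" by (cases z)
  obtain p d where x: "x = Complex p d" by (cases x)
  obtain q s where r: "r = Complex q (-s)" by (metis add.inverse_inverse complex.exhaust)
  have pos: "b > 0" "d \<ge> 0" "s > 0" using assms by (auto simp: z x r)
  \<comment> \<open>the real part, multiplied by \<open>\<bar>x - r\<bar>\<^sup>2\<close>, written as a sum of visibly nonnegative terms\<close>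
  define N where "N = (a - c*q)^2 * d + c * (p - q)^2 * b + s * (a - c*p)^2
      + (b + c * d) * (b + c * s) * (d + s)"
  have "(b + c * d) * (b + c * s) * (d + s) > 0"
    using pos assms by (intro mult_pos_pos add_pos_nonneg add_nonneg_pos) auto
  moreover have "(a - c*q)^2 * d \<ge> 0" "c * (p - q)^2 * b \<ge> 0" "s * (a - c*p)^2 \<ge> 0"
    using pos assms by auto
  ultimately have "N > 0" unfolding N_def by linarith
  moreover have "Re (\<i> * (cnj z - of_real c * x) * (z - of_real c * r) * cnj (x - r)) = N"
    by (simp add: N_def z x r power2_eq_square) algebra
  ultimately show ?thesis
    using \<open>x \<noteq> r\<close> complex_div_cnj[of "z - of_real c * r" "x - r"]
    by (simp add: Re_divide_of_real mult.assoc flip: of_real_power)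
qed

lemma Re_polar_derivative_pos:
  fixes g :: "complex poly"
  assumes "g \<noteq> 0" "{x. poly g x = 0} \<subseteq> {x. Im x < 0}"
    and z: "Im z > 0" and x: "Im x \<ge> 0" and c: "c \<ge> 0" and "degree g > 0"
  shows "Re (\<i> * (cnj z - of_real c * x) * (poly (polar_derivative c z (degree g) g) x / poly g x)) > 0"
proof -
  let ?\<theta> = "\<i> * (cnj z - of_real c * x)"
  let ?L = "\<lambda>g. Re (?\<theta> * (poly (polar_derivative c z (degree g) g) x / poly g x))"
  have "poly g x \<noteq> 0 \<and> ?L g \<ge> 0 \<and> (degree g > 0 \<longrightarrow> ?L g > 0)"
    using assms(1,2)
  proof (induction rule: complex_poly_roots_induct)
    case (const a)
    then show ?case by (simp add: polar_derivative_def)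
  next
    case (mult r g)
    let ?G = "[:-r, 1:] * g"
    have G: "poly ?G x = (x - r) * poly g x" by (simp add: algebra_simps)
    have r: "Im r < 0" using mult(1) by simp
    then have "x \<noteq> r" using x by auto
    have deg: "degree ?G = Suc (degree g)" using mult(2) by (subst degree_mult_eq) auto
    have "poly (polar_derivative c z (degree ?G) ?G) x / poly ?G x
        = poly (polar_derivative c z (degree g) g) x / poly g x + (z - c * r) / (x - r)"
      using mult(3) \<open>x \<noteq> r\<close> unfolding deg polar_derivative_linear_factor G
      by (simp add: field_simps)
    then have "?L ?G = ?L g + Re (?\<theta> * ((z - c * r) / (x - r)))"
      by (simp only: ring_distribs plus_complex.simps)
    with Re_mobius_pos[OF z x r c] mult(3) \<open>x \<noteq> r\<close> G show ?case by simp
  qed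
  with assms show ?thesis by blast
qed

text \<open>
  The quotient is minus the sum of the zeros. It is needed to see that the polar derivative
  loses exactly one degree.
\<close>

lemma Im_subleading_coeff_pos:
  fixes g :: "complex poly"
  assumes "g \<noteq> 0" "{x. poly g x = 0} \<subseteq> {x. Im x < 0}" "degree g = Suc m"
  shows "Im (coeff g m / coeff g (Suc m)) > 0"
proof -
  have "degree g > 0 \<longrightarrow> Im (coeff g (degree g - 1) / lead_coeff g) > 0"
    using assms(1,2)
  proof (induction rule: complex_poly_roots_induct)
    case (mult r g)
    let ?G = "[:-r, 1:] * g"
    have deg: "degree ?G = Suc (degree g)" using mult(2) by (subst degree_mult_eq) auto
    have lead: "lead_coeff ?G = lead_coeff g" by (subst lead_coeff_mult) simp
    have "coeff ?G (degree g) / lead_coeff g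
        = (if degree g = 0 then 0 else coeff g (degree g - 1) / lead_coeff g) - r"
      using mult(2) by (simp add: coeff_pCons field_simps split: nat.splits)
    then show ?case
      unfolding lead unfolding deg using mult(1,3) by auto
  qed simp
  with assms show ?thesis by simp
qed

text \<open>
  Laguerre's theorem for the lower half plane: at a point \<open>x\<close> outside it, all the terms
  \<open>(z - c r) / (x - r)\<close> that add up to the polar derivative divided by \<open>g\<close> lie strictly on the same
  side of a line through \<open>0\<close>, hence do not cancel. The strict inequality
  \<open>Im z > 0\<close> rules out the degenerate case \<open>z = c cnj x\<close>, in which that line is not determined.
\<close>

lemma laguerre:
  fixes g :: "complex poly"
  assumes g: "g \<noteq> 0" "{x. poly g x = 0} \<subseteq> {x. Im x < 0}" "degree g = Suc m"
    and z: "Im z > 0" and c: "c \<ge> 0"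
  defines "h \<equiv> polar_derivative (of_real c) z (Suc m) g"
  shows "h \<noteq> 0" "{x. poly h x = 0} \<subseteq> {x. Im x < 0}" "degree h = m"
proof -
  have "coeff g (Suc m) \<noteq> 0" using g by (metis leading_coeff_0_iff)
  moreover have "coeff h m = c * coeff g m + of_nat (Suc m) * z * coeff g (Suc m)"
    by (simp add: h_def coeff_polar_derivative)
  ultimately have "coeff h m / coeff g (Suc m)
      = c * (coeff g m / coeff g (Suc m)) + of_nat (Suc m) * z"
    by (simp add: add_divide_distrib)
  moreover have "Im (of_real c * u + of_nat (Suc m) * z) = c * Im u + of_nat (Suc m) * Im z" for u
    by (simp del: of_nat_Suc)
  ultimately have "Im (coeff h m / coeff g (Suc m))
      = c * Im (coeff g m / coeff g (Suc m)) + of_nat (Suc m) * Im z"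
    by (simp only:)
  moreover have "c * Im (coeff g m / coeff g (Suc m)) \<ge> 0"
    using c Im_subleading_coeff_pos[OF g] by simp
  moreover have "of_nat (Suc m) * Im z > 0" using z by simp
  ultimately have "Im (coeff h m / coeff g (Suc m)) > 0" by linarith
  then have lead: "coeff h m \<noteq> 0" by auto
  then show "h \<noteq> 0" by auto
  have "coeff h k = 0" if "k > m" for k
    using that g(3) by (cases "k = Suc m") (auto simp: h_def coeff_polar_derivative coeff_eq_0)
  then have "degree h \<le> m" by (simp add: degree_le)
  with lead show "degree h = m" by (meson le_antisym le_degree)
  show "{x. poly h x = 0} \<subseteq> {x. Im x < 0}"
  proof
    fix x assume "x \<in> {x. poly h x = 0}"
    then have "poly (polar_derivative (of_real c) z (degree g) g) x = 0"
      by (simp add: h_def g(3))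
    with Re_polar_derivative_pos[OF g(1,2) z _ c, of x] g(3) show "x \<in> {x. Im x < 0}"
      by (cases "Im x \<ge> 0") auto
  qed
qed

section \<open>The composition theorem of Schur and Szego\<close>

text \<open>
  When the coefficients of \<open>q\<close> and \<open>g\<close> are \<open>(n choose k) a\<^sub>k\<close> and \<open>(n choose k) b\<^sub>k\<close>, this is the value at
  \<open>- z\<close> of their Schur--Szego composition, which has the coefficients \<open>(n choose k) a\<^sub>k b\<^sub>k\<close>.
\<close>

definition szego_sum :: "nat \<Rightarrow> complex poly \<Rightarrow> complex poly \<Rightarrow> complex \<Rightarrow> complex" where
  "szego_sum n q g z = (\<Sum>k\<le>n. coeff q k * (- z) ^ k * (coeff g k / of_nat (n choose k)))"

text \<open>
  In terms of the coefficients \<open>b k\<close> of \<open>g\<close> without their binomial weights, the polar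
  derivative is simply \<open>b k \<mapsto> c * b k + w * b (Suc k)\<close>, up to the factor \<open>Suc m\<close>.
\<close>

lemma coeff_polar_derivative_binomial:
  assumes "k \<le> m"
  shows "coeff (polar_derivative c w (Suc m) g) k / of_nat (m choose k)
    = of_nat (Suc m) * (c * (coeff g k / of_nat (Suc m choose k))
        + w * (coeff g (Suc k) / of_nat (Suc m choose Suc k)))"
proof -
  have "(Suc m - k) * (Suc m choose k) = Suc m * (m choose k)"
    using binomial_absorb_comp[of "Suc m" k] by simp
  then have "of_nat ((Suc m - k) * (Suc m choose k)) = (of_nat (Suc m * (m choose k)) :: complex)"
    by simp
  then have 1: "(of_nat (Suc m) - of_nat k) * of_nat (Suc m choose k)
      = (of_nat (Suc m) * of_nat (m choose k) :: complex)"
    using assms by (simp only: of_nat_mult of_nat_diff le_SucI)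
  have "of_nat (Suc k * (Suc m choose Suc k)) = (of_nat (Suc m * (m choose k)) :: complex)"
    by (simp only: Suc_times_binomial)
  then have 2: "of_nat (Suc k) * of_nat (Suc m choose Suc k)
      = (of_nat (Suc m) * of_nat (m choose k) :: complex)"
    by (simp only: of_nat_mult)
  have nz: "of_nat (m choose k) \<noteq> (0::complex)" "of_nat (Suc m choose k) \<noteq> (0::complex)"
      "of_nat (Suc m choose Suc k) \<noteq> (0::complex)"
    using assms by (simp_all del: binomial_Suc_Suc)
  have "(of_nat (Suc m) - of_nat k) / of_nat (m choose k) = (of_nat (Suc m) / of_nat (Suc m choose k) :: complex)"
    by (rule iffD2[OF frac_eq_eq[OF nz(1,2)] 1])
  moreover have "of_nat (Suc k) / of_nat (m choose k) = (of_nat (Suc m) / of_nat (Suc m choose Suc k) :: complex)"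
    by (rule iffD2[OF frac_eq_eq[OF nz(1,3)] 2])
  moreover have "coeff (polar_derivative c w (Suc m) g) k / of_nat (m choose k)
    = c * coeff g k * ((of_nat (Suc m) - of_nat k) / of_nat (m choose k))
        + w * coeff g (Suc k) * (of_nat (Suc k) / of_nat (m choose k))"
    by (simp only: coeff_polar_derivative add_divide_distrib times_divide_eq_right mult_ac)
  ultimately show ?thesis by (simp only: ring_distribs times_divide_eq_right mult_ac)
qed

text \<open>A linear factor of \<open>q\<close> can be traded for a polar derivative of \<open>g\<close>; this drives the induction.\<close>

lemma szego_sum_linear_factor:
  assumes "degree q \<le> m"
  shows "of_nat (Suc m) * szego_sum (Suc m) ([:-c, 1:] * q) g z
    = - szego_sum m q (polar_derivative c z (Suc m) g) z"
proof -
  define b where "b k = coeff g k / of_nat (Suc m choose k)" for k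
  have q: "coeff q (Suc m) = 0" using assms by (simp add: coeff_eq_0)
  have "szego_sum (Suc m) ([:-c, 1:] * q) g z
      = (\<Sum>k\<le>Suc m. coeff (pCons 0 q) k * (- z) ^ k * b k) - (\<Sum>k\<le>Suc m. c * coeff q k * (- z) ^ k * b k)"
    unfolding szego_sum_def b_def[symmetric] sum_subtractf[symmetric]
    by (rule sum.cong) (simp_all add: algebra_simps)
  also have "(\<Sum>k\<le>Suc m. coeff (pCons 0 q) k * (- z) ^ k * b k)
      = (\<Sum>k\<le>m. coeff q k * (- z) ^ Suc k * b (Suc k))"
    by (subst sum.atMost_Suc_shift) simp
  also have "(\<Sum>k\<le>Suc m. c * coeff q k * (- z) ^ k * b k) = (\<Sum>k\<le>m. c * coeff q k * (- z) ^ k * b k)"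
    by (simp add: q)
  also have "(\<Sum>k\<le>m. coeff q k * (- z) ^ Suc k * b (Suc k)) - \<dots>
      = - (\<Sum>k\<le>m. coeff q k * (- z) ^ k * (c * b k + z * b (Suc k)))"
    unfolding sum_subtractf[symmetric] sum_negf[symmetric]
    by (rule sum.cong) (simp_all add: algebra_simps)
  also have "of_nat (Suc m) * \<dots>
      = - (\<Sum>k\<le>m. coeff q k * (- z) ^ k * (of_nat (Suc m) * (c * b k + z * b (Suc k))))"
    by (simp add: sum_distrib_left mult_ac)
  also have "\<dots> = - szego_sum m q (polar_derivative c z (Suc m) g) z"
    unfolding szego_sum_def b_def
    by (intro arg_cong[where f = uminus] sum.cong refl, subst coeff_polar_derivative_binomial) auto
  finally show ?thesis .
qed

text \<open>
  Every zero \<open>c \<ge> 0\<close> of \<open>q\<close> is removed at the price of one polar derivative, which by Laguerre's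
  theorem keeps the zeros of \<open>g\<close> in the open lower half plane. Once \<open>q\<close> is constant, only the value
  of the remaining \<open>g\<close> at \<open>0\<close> is left, and \<open>0\<close> is not a zero because it lies on the real axis.
\<close>

lemma szego_sum_nonzero:
  assumes "q \<noteq> 0" "{x. poly q x = 0} \<subseteq> complex_of_real ` {0..}" "degree q \<le> n"
    and "g \<noteq> 0" "{x. poly g x = 0} \<subseteq> {x. Im x < 0}" "degree g = n"
    and z: "Im z > 0"
  shows "szego_sum n q g z \<noteq> 0"
  using assms(1-6)
proof (induction arbitrary: n g rule: complex_poly_roots_induct)
  case (const a)
  have "szego_sum n [:a:] g z = (\<Sum>k\<in>{0}. coeff [:a:] k * (- z) ^ k * (coeff g k / of_nat (n choose k)))"
    unfolding szego_sum_def
    by (rule sum.mono_neutral_right) (auto simp: coeff_pCons split: nat.splits)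
  also have "\<dots> = a * poly g 0" by (simp add: poly_0_coeff_0)
  also have "\<dots> \<noteq> 0" using const by auto
  finally show ?case .
next
  case (mult c q)
  have "degree ([:-c, 1:] * q) = Suc (degree q)" using mult(2) by (subst degree_mult_eq) auto
  then obtain m where m: "n = Suc m" "degree q \<le> m" using mult by (cases n) auto
  obtain c' where c': "c = of_real c'" "c' \<ge> 0" using mult(1) by auto
  note L = laguerre[OF mult(5,6) mult(7)[unfolded m] z c'(2), folded c'(1)]
  from szego_sum_linear_factor[OF m(2), of c g z] mult(3)[OF m(2) L] show ?case
    unfolding m by auto
qed

section \<open>Diagonal operators and Pochhammer polynomials\<close>

lemma diagonal_operator_sum:
  assumes "diagonal_operator b \<alpha> T"
  shows "T (\<Sum>k\<in>A. smult (c k) (b k)) = (\<Sum>k\<in>A. smult (c k * \<alpha> k) (b k))"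
proof -
  interpret Vector_Spaces.linear smult smult T
    using assms by (simp add: diagonal_operator_def)
  show ?thesis using assms by (simp add: diagonal_operator_def sum scale)
qed

lemma coeff_diagonal_operator_monom:
  assumes "diagonal_operator (\<lambda>i. monom 1 i) \<alpha> D"
  shows "coeff (D p) k = \<alpha> k * coeff p k"
proof -
  have "D (\<Sum>i\<le>degree p. smult (coeff p i) (monom 1 i))
      = (\<Sum>i\<le>degree p. smult (coeff p i * \<alpha> i) (monom 1 i))"
    by (rule diagonal_operator_sum[OF assms])
  then have "D p = (\<Sum>i\<le>degree p. monom (coeff p i * \<alpha> i) i)"
    by (simp add: smult_monom poly_as_sum_of_monoms)
  then have "coeff (D p) k = (if k \<le> degree p then coeff p k * \<alpha> k else 0)"
    by (simp add: coeff_sum)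
  then show ?thesis by (simp add: coeff_eq_0 mult.commute)
qed

lemma poly_map_poly_of_real:
  assumes "degree p \<le> n"
  shows "poly (map_poly complex_of_real p) z = (\<Sum>k\<le>n. of_real (coeff p k) * z ^ k)"
proof -
  have "poly (map_poly complex_of_real p) z = (\<Sum>k\<le>degree p. of_real (coeff p k) * z ^ k)"
    by (simp add: poly_altdef degree_map_poly coeff_map_poly)
  also have "\<dots> = (\<Sum>k\<le>n. of_real (coeff p k) * z ^ k)"
    using assms by (intro sum.mono_neutral_left) (auto simp: coeff_eq_0)
  finally show ?thesis .
qed

lemma map_poly_of_real_mult:
  "map_poly complex_of_real (p * q) = map_poly of_real p * map_poly of_real q"
  by (rule poly_eqI) (simp add: coeff_map_poly coeff_mult)

lemma map_poly_of_real_prod: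
  "map_poly complex_of_real (\<Prod>i\<in>A. f i) = (\<Prod>i\<in>A. map_poly of_real (f i))"
  by (induction A rule: infinite_finite_induct) (simp_all add: map_poly_of_real_mult)

lemma map_poly_of_real_sum_smult:
  "map_poly complex_of_real (\<Sum>i\<in>A. smult (c i) (f i)) = (\<Sum>i\<in>A. smult (of_real (c i)) (map_poly of_real (f i)))"
  by (rule poly_eqI) (simp add: coeff_map_poly coeff_sum)

lemma poly_pochhammer_poly_of_real:
  "poly (map_poly complex_of_real (pochhammer_poly k)) z = (\<Prod>j<k. z - of_nat j)"
  by (simp add: pochhammer_poly_def map_poly_of_real_prod poly_prod map_poly_pCons)

lemma poly_pochhammer_poly: "poly (pochhammer_poly k) x = (\<Prod>j<k. x - real j)"
  by (simp add: pochhammer_poly_def poly_prod)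

text \<open>The Chu--Vandermonde identity for falling factorials.\<close>

lemma poly_pochhammer_poly_add:
  "poly (pochhammer_poly n) (x + y)
    = (\<Sum>k\<le>n. real (n choose k) * poly (pochhammer_poly (n - k)) y * poly (pochhammer_poly k) x)"
proof -
  have g: "poly (pochhammer_poly k) x = fact k * (x gchoose k)" for k and x :: real
    by (simp add: poly_pochhammer_poly gbinomial_prod_rev atLeast0LessThan)
  have "fact n * (\<Sum>k\<le>n. (x gchoose k) * (y gchoose (n - k)))
      = (\<Sum>k\<le>n. real (n choose k) * (fact (n - k) * (y gchoose (n - k))) * (fact k * (x gchoose k)))"
    unfolding sum_distrib_left
    by (intro sum.cong refl) (simp add: binomial_fact field_simps)
  then show ?thesis
    by (simp add: g gbinomial_Vandermonde[symmetric] atLeast0AtMost)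
qed

text \<open>
  A polynomial with equidistant zeros is a translated Pochhammer polynomial, so its
  coordinates in the Pochhammer basis are explicit.
\<close>

lemma equidistant_poly_expansion:
  "(\<Prod>j<n. [:- (s + real j), 1:])
    = (\<Sum>k\<le>n. smult (real (n choose k) * poly (pochhammer_poly (n - k)) (- s)) (pochhammer_poly k))"
proof -
  have "poly (\<Prod>j<n. [:- (s + real j), 1:]) x = poly (pochhammer_poly n) (x + - s)" for x
    unfolding poly_pochhammer_poly by (simp add: poly_prod algebra_simps)
  then show ?thesis
    by (intro poly_eq_poly_eq_iff[THEN iffD1] ext)
      (simp only: poly_pochhammer_poly_add poly_sum poly_smult)
qed

section \<open>Zeros of the Jensen polynomials\<close>

lemma equidistant_poly_in_HP:
  assumes "s \<ge> 0"
  shows "(\<Prod>j<n. [:- (s + real j), 1:]) \<in> HP_plus_mesh_ge1" (is "?p \<in> _")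
proof -
  have roots: "poly ?p x = 0 \<longleftrightarrow> (\<exists>j<n. x = s + real j)" for x
    by (auto simp: poly_prod)
  have "map_poly complex_of_real ?p = (\<Prod>j<n. [:- of_real (s + real j), 1:])"
    by (simp add: map_poly_of_real_prod map_poly_pCons)
  then have croots: "poly (map_poly complex_of_real ?p) z = 0 \<longleftrightarrow> (\<exists>j<n. z = of_real (s + real j))" for z
  proof -
    have "poly (\<Prod>j<n. [:- complex_of_real (s + real j), 1:]) z = (\<Prod>j<n. z - of_real (s + real j))"
      by (simp add: poly_prod algebra_simps)
    then show ?thesis
      unfolding \<open>map_poly complex_of_real ?p = _\<close> by (simp only: prod_zero_iff finite_lessThan) auto
  qed
  have nz: "?p \<noteq> 0" by simp
  have deg: "degree ?p = n" by (simp add: degree_prod_eq_sum_degree)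
  have simple: "order x ?p \<le> 1" for x
  proof -
    have "order x ?p = count (proots ?p) x" using nz by simp
    also have "\<dots> = (\<Sum>j<n. if s + real j = x then 1 else 0)"
      by (subst proots_prod) (auto simp: count_sum add.commute intro!: sum.cong)
    also have "\<dots> = card {j\<in>{..<n}. s + real j = x}"
      by (simp add: sum.If_cases Int_def)
    also have "\<dots> \<le> 1" by (auto simp: card_le_Suc0_iff_eq)
    finally show ?thesis .
  qed
  have "mesh ?p \<ge> 1"
  proof (cases "degree ?p \<le> 1")
    case False
    let ?S = "{\<bar>x - y\<bar> | x y. poly ?p x = 0 \<and> poly ?p y = 0 \<and> x \<noteq> y}"
    have "?S \<subseteq> (\<lambda>(x, y). \<bar>x - y\<bar>) ` ({x. poly ?p x = 0} \<times> {x. poly ?p x = 0})" by auto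
    then have fin: "finite ?S"
      using poly_roots_finite[OF nz] by (meson finite_SigmaI finite_imageI finite_subset)
    have "poly ?p s = 0" "poly ?p (s + 1) = 0"
      using False unfolding roots deg by (auto intro: exI[of _ 0] exI[of _ 1])
    then have "\<bar>s - (s + 1)\<bar> \<in> ?S" by fastforce
    then have ne: "?S \<noteq> {}" by blast
    have "d \<ge> 1" if "d \<in> ?S" for d
    proof -
      from that obtain i j where "d = \<bar>(s + real i) - (s + real j)\<bar>" "i \<noteq> j"
        unfolding roots by blast
      then show ?thesis by linarith
    qed
    then have "Min ?S \<ge> 1" using fin ne by simp
    then have "ereal (Min ?S) \<ge> 1" by (simp add: one_ereal_def)
    moreover have "\<not> (\<exists>x. order x ?p \<ge> 2)" using simple by (metis not_less_eq_eq numeral_2_eq_2 One_nat_def)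
    ultimately show ?thesis using False by (simp only: mesh_def if_False)
  qed (simp add: mesh_def)
  moreover have "hyperbolic ?p" unfolding hyperbolic_def croots by auto
  moreover have "\<forall>x. poly ?p x = 0 \<longrightarrow> x \<ge> 0" unfolding roots using assms by auto
  ultimately show ?thesis by (simp only: HP_plus_mesh_ge1_def mem_Collect_eq) blast
qed

lemma HP_complex_zero_nonneg:
  assumes "r \<in> HP_plus_mesh_ge1" "r \<noteq> 0" "poly (map_poly complex_of_real r) z = 0"
  obtains t where "z = of_real t" "t \<ge> 0"
proof -
  from assms have "z \<in> \<real>" by (auto simp: HP_plus_mesh_ge1_def hyperbolic_def)
  then obtain t where t: "z = of_real t" by (auto elim: Reals_cases)
  have "poly (map_poly complex_of_real r) (of_real t) = of_real (poly r t)"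
    by (simp add: poly_altdef degree_map_poly coeff_map_poly)
  with assms(3) t have "poly r t = 0" by simp
  with assms t that show ?thesis by (auto simp: HP_plus_mesh_ge1_def)
qed

text \<open>The classical diagonal operator applied to \<open>(1 - x) ^ n\<close>.\<close>

definition jensen_poly :: "(nat \<Rightarrow> real) \<Rightarrow> nat \<Rightarrow> complex poly" where
  "jensen_poly \<alpha> n = (\<Sum>k\<le>n. monom (of_nat (n choose k) * of_real (\<alpha> k) * (-1) ^ k) k)"

lemma coeff_jensen_poly:
  "coeff (jensen_poly \<alpha> n) k = of_nat (n choose k) * of_real (\<alpha> k) * (-1) ^ k"
  by (cases "k \<le> n") (simp_all add: jensen_poly_def coeff_sum)

lemma poly_jensen_poly:
  "poly (jensen_poly \<alpha> n) z = (\<Sum>k\<le>n. of_nat (n choose k) * of_real (\<alpha> k) * (- z) ^ k)"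
  by (simp add: jensen_poly_def poly_sum poly_monom mult.assoc flip: power_mult_distrib)

text \<open>
  The polynomial with zeros \<open>N, N + 1, \<dots>, N + n - 1\<close> is an admissible argument of the discrete
  operator. On the scale \<open>N\<close> its zeros collapse to the point \<open>1\<close>, and the Pochhammer basis becomes
  the monomial basis; its image therefore tends, after rescaling, to the Jensen polynomial.
\<close>

lemma discrete_multiplier_jensen_zeros:
  assumes "discrete_multiplier_sequence \<alpha>" "jensen_poly \<alpha> n \<noteq> 0"
  shows "{z. poly (jensen_poly \<alpha> n) z = 0} \<subseteq> complex_of_real ` {0..}"
proof -
  obtain T where T: "diagonal_operator pochhammer_poly \<alpha> T" "T ` HP_plus_mesh_ge1 \<subseteq> HP_plus_mesh_ge1"
    using assms(1) by (auto simp: discrete_multiplier_sequence_def)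
  define N where "N i = real (Suc i)" for i
  define r where "r i = T (\<Prod>j<n. [:- (N i + real j), 1:])" for i
  \<comment> \<open>the rescaled image; the power of \<open>- 1 / N i\<close> makes every factor converge, with the sign of \<open>(1 - x) ^ n\<close>\<close>
  define f where "f i = smult (of_real ((- 1 / N i) ^ n)) (map_poly complex_of_real (r i) \<circ>\<^sub>p [:0, of_real (N i):])" for i
  have N: "N i > 0" for i by (simp add: N_def)
  have r_HP: "r i \<in> HP_plus_mesh_ge1" for i
    unfolding r_def using T(2) equidistant_poly_in_HP[of "N i" n] N[of i] by auto
  have r: "r i = (\<Sum>k\<le>n. smult (real (n choose k) * poly (pochhammer_poly (n - k)) (- N i) * \<alpha> k)
      (pochhammer_poly k))" for i
    unfolding r_def equidistant_poly_expansion by (rule diagonal_operator_sum[OF T(1)])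
  have poly_f: "poly (f i) z = (\<Sum>k\<le>n. of_nat (n choose k) * of_real (\<alpha> k)
      * of_real (\<Prod>j<n - k. 1 + real j * inverse (N i)) * (\<Prod>j<k. of_nat j * of_real (inverse (N i)) - z))" for i z
  proof -
    have 1: "(- 1 / N i) ^ (n - k) * poly (pochhammer_poly (n - k)) (- N i)
        = (\<Prod>j<n - k. 1 + real j * inverse (N i))" for k
    proof -
      have "(- 1 / N i) ^ (n - k) = (\<Prod>j<n - k. - 1 / N i)" by simp
      then show ?thesis using N[of i] unfolding poly_pochhammer_poly
        by (simp only: prod.distrib[symmetric]) (rule prod.cong, simp_all add: field_simps)
    qed
    have 2: "of_real ((- 1 / N i) ^ k) * (\<Prod>j<k. of_real (N i) * z - of_nat j)
        = (\<Prod>j<k. of_nat j * of_real (inverse (N i)) - z)" for k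
    proof -
      have "of_real ((- 1 / N i) ^ k) = (\<Prod>j<k. complex_of_real (- 1 / N i))" by simp
      then show ?thesis using N[of i]
        by (simp only: prod.distrib[symmetric]) (rule prod.cong, simp_all add: field_simps)
    qed
    have pow: "(- 1 / N i) ^ n = (- 1 / N i) ^ (n - k) * (- 1 / N i) ^ k" if "k \<le> n" for k
      using that by (simp flip: power_add)
    have "poly (f i) z = (\<Sum>k\<le>n. of_real ((- 1 / N i) ^ n) *
        (of_real (real (n choose k) * poly (pochhammer_poly (n - k)) (- N i) * \<alpha> k)
          * (\<Prod>j<k. of_real (N i) * z - of_nat j)))"
      unfolding f_def r map_poly_of_real_sum_smult
      by (simp add: poly_pcompose poly_sum poly_pochhammer_poly_of_real sum_distrib_left mult_ac)
    also have "\<dots> = (\<Sum>k\<le>n. of_nat (n choose k) * of_real (\<alpha> k)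
      * of_real ((- 1 / N i) ^ (n - k) * poly (pochhammer_poly (n - k)) (- N i))
      * (of_real ((- 1 / N i) ^ k) * (\<Prod>j<k. of_real (N i) * z - of_nat j)))"
      by (rule sum.cong[OF refl], subst pow)
        (simp, simp only: of_real_mult of_real_of_nat_eq, algebra)
    finally show ?thesis by (simp only: 1 2)
  qed
  \<comment> \<open>the complement of the ray \<open>{0..}\<close>\<close>
  define U where "U = {z. Im z \<noteq> 0} \<union> {z. Re z < 0}"
  have *: "poly (jensen_poly \<alpha> n) z \<noteq> 0" if "z \<in> U" for z
  proof (rule hurwitz_polynomials[of U f n])
    show "open U" unfolding U_def
      by (intro open_Un open_Collect_neq open_Collect_less continuous_intros)
    show "degree (f i) \<le> n" for i
    proof -
      have "degree (r i) \<le> n"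
        unfolding r by (intro degree_sum_le) (auto simp: degree_pochhammer_poly intro: order_trans[OF degree_smult_le])
      moreover have "degree (f i) \<le> degree (r i)"
        unfolding f_def by (intro order_trans[OF degree_smult_le] order_trans[OF degree_pcompose_le])
          (simp add: degree_map_poly)
      ultimately show ?thesis by simp
    qed
    show "poly (f i) w \<noteq> 0" if f0: "f i \<noteq> 0" and w: "w \<in> U" for i w
    proof
      assume "poly (f i) w = 0"
      then have "poly (map_poly complex_of_real (r i)) (of_real (N i) * w) = 0"
        using N[of i] by (simp add: f_def poly_pcompose mult.commute)
      moreover have "r i \<noteq> 0" using f0 by (auto simp: f_def)
      ultimately obtain t where "of_real (N i) * w = of_real t" "t \<ge> 0"
        using HP_complex_zero_nonneg[OF r_HP] by blast
      then have "w = of_real (t / N i)" using N[of i] by (simp add: field_simps)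
      with \<open>t \<ge> 0\<close> N[of i] w show False by (simp add: U_def field_simps)
    qed
    show "(\<lambda>i. poly (f i) w) \<longlonglongrightarrow> poly (jensen_poly \<alpha> n) w" for w
    proof -
      have N0: "(\<lambda>i. inverse (N i)) \<longlonglongrightarrow> 0"
        unfolding N_def by (rule LIMSEQ_inverse_real_of_nat)
      have "(\<lambda>i. poly (f i) w) \<longlonglongrightarrow> (\<Sum>k\<le>n. of_nat (n choose k) * of_real (\<alpha> k)
          * of_real (\<Prod>j<n - k. 1 + real j * 0) * (\<Prod>j<k. of_nat j * of_real 0 - w))"
        unfolding poly_f by (intro tendsto_intros N0)
      then show ?thesis by (simp add: poly_jensen_poly)
    qed
  qed (use assms that in auto)
  have "Im z = 0 \<and> Re z \<ge> 0" if "poly (jensen_poly \<alpha> n) z = 0" for z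
    by (cases "z \<in> U") (use that * in \<open>auto simp: U_def\<close>)
  then show ?thesis
    by (auto simp: image_iff complex_eq_iff)
qed

section \<open>From the Jensen polynomials to all hyperbolic polynomials\<close>

lemma tendsto_coeff_pcompose_shift:
  fixes P :: "complex poly"
  assumes "(\<lambda>i. c i) \<longlonglongrightarrow> 0"
  shows "(\<lambda>i. coeff (P \<circ>\<^sub>p [:c i, 1:]) k) \<longlonglongrightarrow> coeff P k"
proof (induction P arbitrary: k)
  case (pCons a P)
  have "coeff (pCons a P \<circ>\<^sub>p [:c i, 1:]) k = coeff [:a:] k + c i * coeff (P \<circ>\<^sub>p [:c i, 1:]) k
      + (case k of 0 \<Rightarrow> 0 | Suc m \<Rightarrow> coeff (P \<circ>\<^sub>p [:c i, 1:]) m)" for i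
    by (simp add: pcompose_pCons coeff_pCons split: nat.splits)
  moreover have "(\<lambda>i. case k of 0 \<Rightarrow> 0 | Suc m \<Rightarrow> coeff (P \<circ>\<^sub>p [:c i, 1:]) m)
      \<longlonglongrightarrow> (case k of 0 \<Rightarrow> 0 | Suc m \<Rightarrow> coeff P m)"
    by (cases k) (simp_all add: pCons.IH)
  then have "(\<lambda>i. coeff [:a:] k + c i * coeff (P \<circ>\<^sub>p [:c i, 1:]) k
      + (case k of 0 \<Rightarrow> 0 | Suc m \<Rightarrow> coeff (P \<circ>\<^sub>p [:c i, 1:]) m))
     \<longlonglongrightarrow> coeff [:a:] k + 0 * coeff P k + (case k of 0 \<Rightarrow> 0 | Suc m \<Rightarrow> coeff P m)"
    by (intro tendsto_intros assms pCons.IH)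
  ultimately show ?case by (simp add: coeff_pCons split: nat.splits)
qed simp

text \<open>
  The composition theorem wants the zeros of \<open>g\<close> strictly below the real axis, so \<open>p\<close> is first
  translated by a small imaginary amount and Hurwitz's theorem removes the perturbation. Since
  \<open>szego_sum\<close> of the Jensen polynomial with \<open>g\<close> is the value of the classical operator at \<open>g\<close>, its
  nonvanishing is exactly what is required.
\<close>

lemma diagonal_image_no_zeros_upper_half_plane:
  assumes \<alpha>: "discrete_multiplier_sequence \<alpha>"
    and D: "diagonal_operator (\<lambda>i. monom 1 i) \<alpha> D"
    and p: "hyperbolic p" and Dp: "D p \<noteq> 0" and z: "Im z > 0"
  shows "poly (map_poly complex_of_real (D p)) z \<noteq> 0"
proof -
  define n where "n = degree p"
  define P where "P = map_poly complex_of_real p"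
  define g where "g i = P \<circ>\<^sub>p [:\<i> * of_real (inverse (real (Suc i))), 1:]" for i
  define f where "f i = (\<Sum>k\<le>n. monom (of_real (\<alpha> k) * coeff (g i) k) k)" for i
  have coeff_D: "coeff (D p) k = \<alpha> k * coeff p k" for k
    by (rule coeff_diagonal_operator_monom[OF D])
  then have "degree (D p) \<le> n"
    by (auto intro!: degree_le simp: n_def coeff_eq_0)
  note poly_D = poly_map_poly_of_real[OF this, unfolded coeff_D]
  obtain k where k: "coeff (D p) k \<noteq> 0" using Dp by (metis leading_coeff_0_iff)
  then have "k \<le> n" "\<alpha> k \<noteq> 0" unfolding n_def coeff_D by (auto intro: le_degree)
  then have "coeff (jensen_poly \<alpha> n) k \<noteq> 0" by (simp add: coeff_jensen_poly)
  then have q: "jensen_poly \<alpha> n \<noteq> 0" by auto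
  have degq: "degree (jensen_poly \<alpha> n) \<le> n"
    by (rule degree_le) (simp add: coeff_jensen_poly)
  have "p \<noteq> 0" using k by (auto simp: coeff_D)
  have deg_g: "degree (g i) = n" for i
    by (simp add: g_def degree_pcompose P_def degree_map_poly n_def)
  have g0: "g i \<noteq> 0" for i
  proof -
    have "P \<noteq> 0" using \<open>p \<noteq> 0\<close> by (simp add: P_def poly_eq_iff coeff_map_poly)
    then show ?thesis unfolding g_def by (subst pcompose_eq_0_iff) simp_all
  qed
  have g_zeros: "{x. poly (g i) x = 0} \<subseteq> {x. Im x < 0}" for i
  proof
    fix x assume "x \<in> {x. poly (g i) x = 0}"
    then have zero: "poly P (x + \<i> * of_real (inverse (real (Suc i)))) = 0"
      by (simp add: g_def poly_pcompose add.commute)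
    define e where "e = inverse (real (Suc i))"
    have "x + \<i> * of_real e \<in> \<real>"
      using p \<open>p \<noteq> 0\<close> zero unfolding hyperbolic_def P_def e_def by blast
    then have "Im x + e = 0" by (simp add: complex_is_Real_iff)
    moreover have "e > 0" by (simp add: e_def)
    ultimately show "x \<in> {x. Im x < 0}" by simp
  qed
  have poly_f: "poly (f i) w = szego_sum n (jensen_poly \<alpha> n) (g i) w" for i w
  proof -
    have "of_real (\<alpha> k) * coeff (g i) k * w ^ k
        = coeff (jensen_poly \<alpha> n) k * (- w) ^ k * (coeff (g i) k / of_nat (n choose k))"
      if "k \<le> n" for k
    proof -
      have "(- 1) ^ k * (- w) ^ k = w ^ k" by (simp flip: power_mult_distrib)
      moreover have "of_nat (n choose k) \<noteq> (0 :: complex)" using that by simp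
      ultimately show ?thesis by (simp add: coeff_jensen_poly field_simps)
    qed
    then show ?thesis by (simp add: f_def szego_sum_def poly_sum poly_monom)
  qed
  show ?thesis
  proof (rule hurwitz_polynomials[of "{w. Im w > 0}" f n])
    show "open {w. Im w > 0}" by (intro open_Collect_less continuous_intros)
    show "degree (f i) \<le> n" for i
      unfolding f_def by (intro degree_sum_le) (auto intro: order_trans[OF degree_monom_le])
    show "poly (f i) w \<noteq> 0" if "w \<in> {w. Im w > 0}" for i w
      unfolding poly_f using that
      by (intro szego_sum_nonzero q discrete_multiplier_jensen_zeros \<alpha> degq g0 g_zeros deg_g) simp
    show "(\<lambda>i. poly (f i) w) \<longlonglongrightarrow> poly (map_poly complex_of_real (D p)) w" for w
    proof -
      have "(\<lambda>i. \<i> * of_real (inverse (real (Suc i)))) \<longlonglongrightarrow> \<i> * of_real 0"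
        by (intro tendsto_intros LIMSEQ_inverse_real_of_nat)
      then have "(\<lambda>i. coeff (g i) k) \<longlonglongrightarrow> coeff P k" for k
        unfolding g_def by (intro tendsto_coeff_pcompose_shift) simp
      then have "(\<lambda>i. poly (f i) w) \<longlonglongrightarrow> (\<Sum>k\<le>n. of_real (\<alpha> k) * coeff P k * w ^ k)"
        unfolding f_def poly_sum poly_monom by (intro tendsto_intros)
      then show ?thesis by (simp add: poly_D P_def coeff_map_poly)
    qed
    show "map_poly complex_of_real (D p) \<noteq> 0"
      using k by (auto simp: poly_eq_iff coeff_map_poly)
  qed (use z in auto)
qed

theorem proposition5:
  fixes \<alpha> :: "nat \<Rightarrow> real"
  assumes "discrete_multiplier_sequence \<alpha>"
  shows "multiplier_sequence \<alpha>"
proof -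
  obtain D where D: "diagonal_operator (\<lambda>i. monom 1 i) \<alpha> D"
    using diagonal_operator_monom_ex1 by blast
  have "hyperbolic (D p)" if p: "hyperbolic p" for p
  proof (cases "D p = 0")
    case False
    have "z \<in> \<real>" if zero: "poly (map_poly complex_of_real (D p)) z = 0" for z
    proof -
      have "poly (map_poly complex_of_real (D p)) (cnj z) = 0"
        using zero by (subst real_poly_cnj_root_iff) (simp_all add: coeff_map_poly)
      then have "\<not> Im z > 0" "\<not> Im (cnj z) > 0"
        using zero diagonal_image_no_zeros_upper_half_plane[OF assms D p False] by blast+
      then show ?thesis by (simp add: complex_is_Real_iff)
    qed
    then show ?thesis by (simp add: hyperbolic_def)
  qed (simp add: hyperbolic_def)
  with D show ?thesis by (auto simp: multiplier_sequence_def)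
qed

end
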